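(* Let $\ell \ge 1$ be a fixed integer. For $n\in\mathbb{N}$, let $L_{\ell-1}$ be the lifetime sum of the $(\ell-1)$-st reduced persistent homology of the $\ell$-Bernoulli cell complex process on the $\ell$-cubical lattice $\mathrm{CL}(n)$ in $\mathbb{R}^{\ell+1}$. Then $$\mathbb{E}[L_{\ell-1}] = O(n^{\ell+1})\qquad\text{as } n\to\infty.$$
   Context: Cubical lattice: an elementary interval is a closed interval $[a,a+1]$ (nondegenerate) or $[a,a]$ (degenerate) with $a\in\mathbb{Z}$. An elementary cube in $\mathbb{R}^{\ell+1}$ is a product $Q=I_0\times\cdots\times I_\ell$ of elementary intervals; its dimension is the number of nondegenerate factors. For $n\in\mathbb{N}$ (positive integer), $\widetilde{\mathrm{CL}}(n)$ is the cell complex consisting of all elementary cubes contained in $[0,n]^{\ell+1}\subset\mathbb{R}^{\ell+1}$, and $\mathrm{CL}(n)$ is its $\ell$-skeleton. Bernoulli process: for a finite cell complex $X$, $X_\ell$ denotes the set of $\ell$-cells and $X^{\ell-1}$ the $(\ell-1)$-skeleton. Let $\{t_\sigma:\sigma\in X_\ell\}$ be i.i.d. random variables uniform on $[0,1]$. The $\ell$-Bernoulli cell complex process on $X$ is the random filtration $X^\ell(t)=X^{\ell-1}\sqcup\{\sigma\in X_\ell: t_\sigma\le t\}$, $0\le t\le 1$ (saturation time $T=1$). Lifetime sum: homology is cellular with coefficients in a field $K$ of characteristic zero. The persistent homology of the filtration in degree $k$ decomposes into finitely many intervals with birth time $b_i$ and death time $d_i$ (a class born at $b_i$ persists for $b_i\le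 t<d_i$); classes that never die are assigned death time $d_i=T=1$. The lifetime is $d_i-b_i$, and $L_k$ is the sum of all lifetimes in the $k$-th reduced persistent homology (for $k=0$ one generator of maximal lifetime is omitted). Equivalently, $L_k=\int_0^1\tilde\beta_k(X^\ell(t))\,dt$, where $\tilde\beta_k$ is the $k$-th reduced Betti number over $K$. *)

theory Defs
  imports "HOL-Probability.Probability" "HOL-Library.Landau_Symbols"
begin

section \<open>Elementary cubes and the cubical lattice\<close>

text \<open>\<open>Degenerate a\<close> stands for $[a,a]$ and \<open>Nondegenerate a\<close> for $[a,a+1]$.\<close>

datatype elementary_interval = Degenerate int | Nondegenerate int

fun interval_set :: "elementary_interval \<Rightarrow> real set" where
  "interval_set (Degenerate a) = {of_int a..of_int a}"
| "interval_set (Nondegenerate a) = {of_int a..of_int a + 1}"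

fun nondegenerate :: "elementary_interval \<Rightarrow> bool" where
  "nondegenerate (Degenerate a) = False"
| "nondegenerate (Nondegenerate a) = True"

fun lower_end :: "elementary_interval \<Rightarrow> elementary_interval" where
  "lower_end (Degenerate a) = Degenerate a"
| "lower_end (Nondegenerate a) = Degenerate a"

fun upper_end :: "elementary_interval \<Rightarrow> elementary_interval" where
  "upper_end (Degenerate a) = Degenerate a"
| "upper_end (Nondegenerate a) = Degenerate (a + 1)"

text \<open>An elementary cube $I_0\times\dots\times I_{m-1}$ in $\mathbb{R}^m$ is the list of its
  factors. Points of $\mathbb{R}^m$ are lists of length $m$.\<close>

type_synonym cube = "elementary_interval list"

definition cube_set :: "cube \<Rightarrow> real list set" where
  "cube_set Q = listset (map interval_set Q)"

definition cube_dim :: "cube \<Rightarrow> nat" where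
  "cube_dim Q = card {i. i < length Q \<and> nondegenerate (Q ! i)}"

definition cells :: "cube set \<Rightarrow> nat \<Rightarrow> cube set" where
  "cells X k = {Q \<in> X. cube_dim Q = k}"

definition skeleton :: "cube set \<Rightarrow> nat \<Rightarrow> cube set" where
  "skeleton X k = {Q \<in> X. cube_dim Q \<le> k}"

definition full_cubical_lattice :: "nat \<Rightarrow> nat \<Rightarrow> cube set" where
  "full_cubical_lattice l n =
     {Q. length Q = l + 1 \<and> cube_set Q \<subseteq> listset (replicate (l + 1) {0..real n})}"

definition cubical_lattice :: "nat \<Rightarrow> nat \<Rightarrow> cube set" where
  "cubical_lattice l n = skeleton (full_cubical_lattice l n) l"


section \<open>Reduced cellular homology over a field\<close>

text \<open>Cells carry the product orientation: the boundary of $Q$ is the sum, over the nondegenerate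
  factors $I_j$ of $Q$, of $(-1)^r$ times (upper minus lower face in direction $j$), where $r$ is
  the number of nondegenerate factors before $I_j$. \<open>incidence Q P\<close> is the coefficient of $P$
  in it.\<close>

definition incidence :: "cube \<Rightarrow> cube \<Rightarrow> int" where
  "incidence Q P =
     (\<Sum>j | j < length Q \<and> nondegenerate (Q ! j).
        (- 1) ^ card {i. i < j \<and> nondegenerate (Q ! i)} *
        ((if P = Q[j := upper_end (Q ! j)] then 1 else 0)
         - (if P = Q[j := lower_end (Q ! j)] then 1 else 0)))"

text \<open>Chains of a complex are functions supported on its cells; complexes are assumed finite
  throughout, so that all sums below are finite.\<close>

definition chains :: "cube set \<Rightarrow> nat \<Rightarrow> (cube \<Rightarrow> 'k::field) set" where
  "chains X k = {c. \<forall>Q. Q \<notin> cells X k \<longrightarrow> c Q = 0}"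

definition boundary :: "(cube \<Rightarrow> 'k::field) \<Rightarrow> cube \<Rightarrow> 'k" where
  "boundary c = (\<lambda>P. \<Sum>Q | c Q \<noteq> 0. c Q * of_int (incidence Q P))"

definition augmentation :: "(cube \<Rightarrow> 'k::field) \<Rightarrow> 'k" where
  "augmentation c = (\<Sum>Q | c Q \<noteq> 0. c Q)"

definition reduced_cycles :: "cube set \<Rightarrow> nat \<Rightarrow> (cube \<Rightarrow> 'k::field) set" where
  "reduced_cycles X k =
     {c \<in> chains X k. if k = 0 then augmentation c = 0 else boundary c = (\<lambda>_. 0)}"

definition boundaries :: "cube set \<Rightarrow> nat \<Rightarrow> (cube \<Rightarrow> 'k::field) set" where
  "boundaries X k = boundary ` chains X (k + 1)"

definition homology_class :: "cube set \<Rightarrow> nat \<Rightarrow> (cube \<Rightarrow> 'k::field) \<Rightarrow> (cube \<Rightarrow> 'k) set" where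
  "homology_class X k c = {(\<lambda>Q. c Q + e Q) | e. e \<in> boundaries X k}"

definition reduced_homology :: "cube set \<Rightarrow> nat \<Rightarrow> (cube \<Rightarrow> 'k::field) set set" where
  "reduced_homology X k = homology_class X k ` reduced_cycles X k"


section \<open>Persistent homology and lifetime sums\<close>

text \<open>A decomposition of the reduced persistent homology in degree \<open>k\<close> of the filtration
  $(F(t))_{0\le t\le 1}$ into finitely many intervals $[b_i,d_i)$, with $d_i=\infty$ for classes
  that never die. The generator of the \<open>i\<close>-th interval is the class, born at $b_i$, of a cycle
  $z_i$ of $F(b_i)$; its image under the map induced by inclusion $F(b_i)\subseteq F(t)$ is the
  class of $z_i$ in $F(t)$, which has to vanish for $t\ge d_i$. For every \<open>t\<close>, the classes of the
  $z_i$ with $b_i\le t<d_i$ have to form a basis of the homology of $F(t)$. This is exactly an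
  isomorphism of the direct sum of the interval modules with the persistent homology.\<close>

definition interval_decomposition ::
  "(real \<Rightarrow> cube set) \<Rightarrow> nat \<Rightarrow> nat set \<Rightarrow> (nat \<Rightarrow> real) \<Rightarrow> (nat \<Rightarrow> ereal)
     \<Rightarrow> (nat \<Rightarrow> cube \<Rightarrow> 'k::field) \<Rightarrow> bool" where
  "interval_decomposition F k I b d z \<longleftrightarrow>
     finite I \<and>
     (\<forall>i\<in>I. 0 \<le> b i \<and> b i \<le> 1 \<and> ereal (b i) < d i \<and> (d i \<le> 1 \<or> d i = \<infinity>)) \<and>
     (\<forall>i\<in>I. z i \<in> reduced_cycles (F (b i)) k) \<and>
     (\<forall>i\<in>I. \<forall>t\<in>{0..1}. d i \<le> ereal t \<longrightarrow>
        homology_class (F t) k (z i) = homology_class (F t) k (\<lambda>_. 0)) \<and>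
     (\<forall>t\<in>{0..1}. let A = {i\<in>I. b i \<le> t \<and> ereal t < d i} in
        \<forall>h \<in> reduced_homology (F t) k. \<exists>!a. a \<in> extensional A \<and>
          h = homology_class (F t) k (\<lambda>Q. \<Sum>i\<in>A. a i * z i Q))"

text \<open>Classes that never die are assigned the saturation time as death time.\<close>

definition death_time :: "ereal \<Rightarrow> real" where
  "death_time d = (if d = \<infinity> then 1 else real_of_ereal d)"

text \<open>The barcode of a finite filtration exists and is unique up to reordering, so the definite
  description below is well defined. The first argument only fixes the coefficient field.\<close>

definition lifetime_sum :: "'k::field itself \<Rightarrow> (real \<Rightarrow> cube set) \<Rightarrow> nat \<Rightarrow> real" where
  "lifetime_sum K F k =
     (THE L. \<exists>I b d (z :: nat \<Rightarrow> cube \<Rightarrow> 'k).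
        interval_decomposition F k I b d z \<and> L = (\<Sum>i\<in>I. death_time (d i) - b i))"


section \<open>The Bernoulli process\<close>

text \<open>\<open>\<tau>\<close> is a realisation of the family of times $t_\sigma$.\<close>

definition bernoulli_process :: "cube set \<Rightarrow> nat \<Rightarrow> (cube \<Rightarrow> real) \<Rightarrow> real \<Rightarrow> cube set" where
  "bernoulli_process X l \<tau> t = skeleton X (l - 1) \<union> {\<sigma> \<in> cells X l. \<tau> \<sigma> \<le> t}"

definition iid_uniform :: "'w measure \<Rightarrow> 'i set \<Rightarrow> ('i \<Rightarrow> 'w \<Rightarrow> real) \<Rightarrow> bool" where
  "iid_uniform M J \<tau> \<longleftrightarrow>
     prob_space.indep_vars M (\<lambda>_. borel) \<tau> J \<and>
     (\<forall>\<sigma>\<in>J. distr M borel (\<tau> \<sigma>) = uniform_measure lborel {0..1})"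

end

theory Submission
  imports Defs "HOL-Library.Function_Algebras"
begin

text \<open>The $(\ell-1)$-skeleton is present from time 0 on, so the space $Z$ of reduced cycles is constant
  and only the space $B_t$ of boundaries grows. A basis of $Z$ adapted to the finite chain of
  subspaces $B_t\cap Z$ gives an interval decomposition with all births at 0; the intersection with
  $Z$ makes $\partial\partial=0$ unnecessary. In every decomposition the number of intervals
  alive at time $t$ is $\dim Z-\dim(B_t\cap Z)$, and the lifetime sum is the integral of this number
  over $[0,1)$, hence unique and at most $\dim Z$. This is bounded by the number of
  $(\ell-1)$-cells, which is $O(n^{\ell+1})$, for every realisation of the process. Measurability
  of the lifetime sum plays no role, since the Bochner integral of a function that is not integrable is 0.\<close>

section \<open>Linear algebra: bases modulo a subspace\<close>

text \<open>For subspaces \<open>V\<close> and \<open>B\<close>, finite \<open>A\<close> and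
  \<open>z\<close> mapping \<open>A\<close> into \<open>V\<close>, this says that the classes of the
  \<open>z i\<close> form a basis of \<open>V\<close> modulo \<open>B \<inter> V\<close>. Avoiding
  the quotient matches the last clause of \<open>interval_decomposition\<close>; extensionality
  fixes the coefficient function outside \<open>A\<close>.\<close>

definition basis_modulo ::
  "('a \<Rightarrow> 'b \<Rightarrow> 'b) \<Rightarrow> 'b::ab_group_add set \<Rightarrow> 'b set \<Rightarrow> 'i set \<Rightarrow> ('i \<Rightarrow> 'b) \<Rightarrow> bool" where
  "basis_modulo sc V B A z \<longleftrightarrow>
     (\<forall>v\<in>V. \<exists>!a. a \<in> extensional A \<and> v - (\<Sum>i\<in>A. sc (a i) (z i)) \<in> B)"

context vector_space
begin

text \<open>Induction that adds the largest index last: a set adapted to the smaller spaces is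
  extended to a basis of the largest one. The earlier spanning conditions survive because
  \<open>E' \<inter> W t\<close> contains \<open>E \<inter> W t\<close> and stays inside the
  subspace \<open>W t\<close>.\<close>

lemma filtration_basis_exists:
  fixes W :: "'t::linorder \<Rightarrow> 'b set"
  assumes "finite T"
    and "\<And>t. t \<in> T \<Longrightarrow> subspace (W t)"
    and "\<And>s t. s \<in> T \<Longrightarrow> t \<in> T \<Longrightarrow> s \<le> t \<Longrightarrow> W s \<subseteq> W t"
  shows "\<exists>E. independent E \<and> E \<subseteq> (\<Union>t\<in>T. W t) \<and> (\<forall>t\<in>T. span (E \<inter> W t) = W t)"
  using assms
proof (induction T rule: finite_linorder_max_induct)
  case empty
  show ?case by (intro exI[of _ "{}"] conjI independent_empty) auto
next
  case (insert b T)
  then obtain E where E: "independent E" "E \<subseteq> (\<Union>t\<in>T. W t)" "\<forall>t\<in>T. span (E \<inter> W t) = W t"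
    by auto
  have mono: "W t \<subseteq> W b" if "t \<in> T" for t
    using insert.prems(2)[of t b] insert.hyps(2) that less_imp_le by blast
  with E(2) have "E \<subseteq> W b" by blast
  with E(1) obtain E' where E': "E \<subseteq> E'" "E' \<subseteq> W b" "independent E'" "W b \<subseteq> span E'"
    using maximal_independent_subset_extend by metis
  have "span (E' \<inter> W t) = W t" if t: "t \<in> insert b T" for t
  proof
    show "span (E' \<inter> W t) \<subseteq> W t"
      using insert.prems(1)[OF t] by (intro span_minimal) auto
    show "W t \<subseteq> span (E' \<inter> W t)"
    proof (cases "t = b")
      case True
      with E' show ?thesis by (simp add: Int_absorb2)
    next
      case False
      with t have "W t = span (E \<inter> W t)" using E(3) by auto
      also have "\<dots> \<subseteq> span (E' \<inter> W t)" using E'(1) by (intro span_mono) auto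
      finally show ?thesis .
    qed
  qed
  with E' show ?case by (intro exI[of _ E']) auto
qed

text \<open>The vectors \<open>z i\<close> together with a basis of \<open>B \<inter> V\<close> form
  a basis of \<open>V\<close>, so cardinalities add up. The finite spanning set \<open>F\<close>
  makes this basis finite and bounds the dimension.\<close>

lemma basis_modulo_card:
  assumes V: "subspace V" "V \<subseteq> span F" "finite F" and B: "subspace B"
    and A: "finite A" "z ` A \<subseteq> V" and basis: "basis_modulo scale V B A z"
  shows "card A + dim (B \<inter> V) = dim V" and "dim V \<le> card F"
proof -
  \<comment> \<open>Uniqueness is applied to the vector 0: the given coefficients and the zero
    coefficients, both restricted to \<open>A\<close>, represent it modulo \<open>B\<close> and
    therefore agree.\<close>
  have indep: "a i = 0" if a: "(\<Sum>i\<in>A. scale (a i) (z i)) \<in> B" and i: "i \<in> A" for a i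
  proof -
    have "\<exists>!a. a \<in> extensional A \<and> 0 - (\<Sum>i\<in>A. scale (a i) (z i)) \<in> B"
      using basis subspace_0[OF V(1)] unfolding basis_modulo_def by blast
    moreover have "0 - (\<Sum>i\<in>A. scale (restrict a A i) (z i)) \<in> B"
      using subspace_neg[OF B a] by (simp cong: sum.cong)
    moreover have "0 - (\<Sum>i\<in>A. scale (restrict (\<lambda>_. 0) A i) (z i)) \<in> B"
      using subspace_0[OF B] by (simp cong: sum.cong)
    ultimately have "restrict a A = restrict (\<lambda>_. 0) A" by blast
    with i show ?thesis by (metis restrict_apply')
  qed
  have inj: "inj_on z A"
  proof (rule inj_onI, rule ccontr)
    fix i j assume ij: "i \<in> A" "j \<in> A" "z i = z j" "i \<noteq> j"
    \<comment> \<open>Coefficients 1 at \<open>i\<close> and -1 at \<open>j\<close> would give a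
      nontrivial combination equal to 0, hence in \<open>B\<close>.\<close>
    let ?a = "\<lambda>k. (if k = i then 1 else 0) - (if k = j then 1 else 0)"
    have "(\<Sum>k\<in>A. scale (?a k) (z k)) = z i - z j"
    proof -
      have "scale (?a k) (z k) = (if k = i then z k else 0) - (if k = j then z k else 0)" for k
        by (simp add: scale_left_diff_distrib)
      then show ?thesis using A ij by (simp add: sum_subtractf sum.delta)
    qed
    then have "(\<Sum>k\<in>A. scale (?a k) (z k)) \<in> B" using ij subspace_0[OF B] by simp
    from indep[OF this ij(1)] ij(4) show False by simp
  qed
  let ?W = "B \<inter> V"
  have W: "subspace ?W" using B V by (intro subspace_inter)
  obtain E where E: "E \<subseteq> ?W" "independent E" "?W \<subseteq> span E" "card E = dim ?W"
    using basis_exists by blast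
  have finE: "finite E"
    using independent_span_bound[OF V(3) E(2)] E(1) V(2) by auto
  have indepA: "u v = 0" if u: "(\<Sum>v\<in>z ` A. scale (u v) v) \<in> B" and v: "v \<in> z ` A" for u v
    using indep[of "\<lambda>i. u (z i)"] u v by (auto simp: sum.reindex[OF inj])
  have disj: "z ` A \<inter> E = {}"
  proof (rule ccontr)
    assume "z ` A \<inter> E \<noteq> {}"
    then obtain v where v: "v \<in> z ` A" "v \<in> E" by auto
    have "(\<Sum>w\<in>z ` A. scale (if w = v then 1 else 0) w) = (\<Sum>w\<in>z ` A. if w = v then w else 0)"
      by (intro sum.cong) auto
    also have "\<dots> = v" using v A by simp
    finally have "(\<Sum>w\<in>z ` A. scale (if w = v then 1 else 0) w) \<in> B" using v E by auto
    from indepA[OF this v(1)] show False by simp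
  qed
  \<comment> \<open>In a linear relation the part over the image of \<open>z\<close> is minus the
    part over \<open>E\<close> and so lies in \<open>B\<close>. Its coefficients vanish by
    \<open>indepA\<close>, and those on \<open>E\<close> by independence of
    \<open>E\<close>.\<close>
  have ind: "independent (z ` A \<union> E)"
  proof
    assume "dependent (z ` A \<union> E)"
    then obtain u v where uv: "v \<in> z ` A \<union> E" "u v \<noteq> 0" "(\<Sum>v\<in>z ` A \<union> E. scale (u v) v) = 0"
      using A finE by (auto simp: dependent_finite)
    then have eq: "(\<Sum>v\<in>z ` A. scale (u v) v) + (\<Sum>v\<in>E. scale (u v) v) = 0"
      using A finE disj by (simp add: sum.union_disjoint)
    then have "(\<Sum>v\<in>z ` A. scale (u v) v) = - (\<Sum>v\<in>E. scale (u v) v)"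
      by (simp add: eq_neg_iff_add_eq_0)
    also have "\<dots> \<in> B" using E by (intro subspace_neg[OF B] subspace_sum[OF B] subspace_scale[OF B]) auto
    finally have 0: "u w = 0" if "w \<in> z ` A" for w using indepA that by blast
    with eq have "(\<Sum>v\<in>E. scale (u v) v) = 0" by simp
    then have "u w = 0" if "w \<in> E" for w using independentD[OF E(2) finE] that by blast
    with 0 uv show False by blast
  qed
  have span: "V \<subseteq> span (z ` A \<union> E)"
  proof
    fix v assume v: "v \<in> V"
    with basis obtain a where a: "v - (\<Sum>i\<in>A. scale (a i) (z i)) \<in> B"
      unfolding basis_modulo_def by blast
    have "(\<Sum>i\<in>A. scale (a i) (z i)) \<in> V"
      using A by (intro subspace_sum[OF V(1)] subspace_scale[OF V(1)]) auto
    with v a have "v - (\<Sum>i\<in>A. scale (a i) (z i)) \<in> ?W" using subspace_diff[OF V(1)] by auto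
    with E have "v - (\<Sum>i\<in>A. scale (a i) (z i)) \<in> span (z ` A \<union> E)"
      using span_mono[of E "z ` A \<union> E"] by auto
    moreover have "(\<Sum>i\<in>A. scale (a i) (z i)) \<in> span (z ` A \<union> E)"
      by (intro span_sum span_scale span_base) auto
    ultimately show "v \<in> span (z ` A \<union> E)" using span_add by fastforce
  qed
  have "card (z ` A \<union> E) = dim V"
    using A E ind span by (intro basis_card_eq_dim) auto
  then show "card A + dim ?W = dim V"
    using A finE disj E(4) inj by (simp add: card_Un_disjoint card_image)
  show "dim V \<le> card F" using V by (intro dim_le_card)
qed

text \<open>Existence: expand \<open>v\<close> in \<open>E\<close> and drop the terms lying in
  \<open>B\<close>. Uniqueness: the difference of two solutions gives a combination of
  \<open>E - B\<close> that lies in \<open>B\<close> and in \<open>V\<close>, hence in the span of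
  \<open>E \<inter> B\<close>; independence of \<open>E\<close> then forces it to be
  trivial.\<close>

lemma basis_modulo_complement:
  assumes E: "independent E" "finite E" "span E = V" and W: "span (E \<inter> B) = B \<inter> V"
    and B: "subspace B"
    and z: "bij_betw z A (E - B)"
  shows "basis_modulo scale V B A z"
  unfolding basis_modulo_def
proof
  fix v assume "v \<in> V"
  then obtain r where r: "v = (\<Sum>e\<in>E. scale (r e) e)" using E span_finite[of E] by auto
  have finA: "finite A" using z E bij_betw_finite by blast
  have inj: "inj_on z A" and im: "z ` A = E - B" using z by (auto simp: bij_betw_def)
  have split: "(\<Sum>e\<in>E. f e) = (\<Sum>i\<in>A. f (z i)) + (\<Sum>e\<in>E \<inter> B. f e)" for f :: "'b \<Rightarrow> 'b"
  proof -
    have "(\<Sum>e\<in>E. f e) = (\<Sum>e\<in>E - B. f e) + (\<Sum>e\<in>E \<inter> B. f e)"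
      using E by (subst sum.union_disjoint[symmetric]) (auto intro: sum.cong)
    then show ?thesis by (simp add: im[symmetric] sum.reindex[OF inj])
  qed
  have ex: "v - (\<Sum>i\<in>A. scale (restrict (r \<circ> z) A i) (z i)) \<in> B"
  proof -
    have "v - (\<Sum>i\<in>A. scale (restrict (r \<circ> z) A i) (z i)) = (\<Sum>e\<in>E \<inter> B. scale (r e) e)"
      unfolding r by (subst split) simp
    also have "\<dots> \<in> B" by (intro subspace_sum[OF B] subspace_scale[OF B]) auto
    finally show ?thesis .
  qed
  show "\<exists>!a. a \<in> extensional A \<and> v - (\<Sum>i\<in>A. scale (a i) (z i)) \<in> B"
  proof (rule ex1I)
    show "restrict (r \<circ> z) A \<in> extensional A \<and> v - (\<Sum>i\<in>A. scale (restrict (r \<circ> z) A i) (z i)) \<in> B"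
      using ex by simp
  next
    fix a assume a: "a \<in> extensional A \<and> v - (\<Sum>i\<in>A. scale (a i) (z i)) \<in> B"
    let ?d = "\<lambda>i. a i - restrict (r \<circ> z) A i"
    let ?s = "\<Sum>i\<in>A. scale (?d i) (z i)"
    have "?s = (v - (\<Sum>i\<in>A. scale (restrict (r \<circ> z) A i) (z i))) - (v - (\<Sum>i\<in>A. scale (a i) (z i)))"
      by (simp add: scale_left_diff_distrib sum_subtractf)
    also have "\<dots> \<in> B" using subspace_diff[OF B] ex a by blast
    finally have "?s \<in> B" .
    moreover have "?s \<in> span E" using im by (intro span_sum span_scale span_base) auto
    ultimately have "?s \<in> span (E \<inter> B)" using W E by auto
    then obtain c where c: "?s = (\<Sum>e\<in>E \<inter> B. scale (c e) e)"
      using span_finite[of "E \<inter> B"] E by auto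
    \<comment> \<open>The two expansions of \<open>?s\<close>, over \<open>E - B\<close> and over
      \<open>E \<inter> B\<close>, are subtracted to form one relation on \<open>E\<close>.\<close>
    define u where "u e = (if e \<in> B then - c e else ?d (the_inv_into A z e))" for e
    have "(\<Sum>e\<in>E. scale (u e) e) = (\<Sum>i\<in>A. scale (u (z i)) (z i)) + (\<Sum>e\<in>E \<inter> B. scale (u e) e)"
      by (rule split)
    also have "(\<Sum>i\<in>A. scale (u (z i)) (z i)) = ?s"
      using im inj by (intro sum.cong refl) (auto simp: u_def the_inv_into_f_f)
    also have "(\<Sum>e\<in>E \<inter> B. scale (u e) e) = - ?s"
      unfolding c by (simp add: u_def sum_negf)
    finally have "(\<Sum>e\<in>E. scale (u e) e) = 0" by simp
    then have 0: "u e = 0" if "e \<in> E" for e using independentD[OF E(1,2)] that by blast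
    show "a = restrict (r \<circ> z) A"
    proof (rule extensionalityI)
      fix i assume i: "i \<in> A"
      with im have "z i \<in> E" "z i \<notin> B" by auto
      with 0[of "z i"] i inj show "a i = restrict (r \<circ> z) A i" by (simp add: u_def the_inv_into_f_f)
    qed (use a in auto)
  qed
qed

end

section \<open>Chains, cycles and boundaries as vector spaces of functions\<close>

definition pointwise_scale :: "'k::field \<Rightarrow> ('x \<Rightarrow> 'k) \<Rightarrow> 'x \<Rightarrow> 'k" where
  "pointwise_scale a f = (\<lambda>x. a * f x)"

lemma pointwise_scale_apply [simp]: "pointwise_scale a f x = a * f x"
  by (simp add: pointwise_scale_def)

interpretation fun_space: vector_space "pointwise_scale :: 'k::field \<Rightarrow> ('x \<Rightarrow> 'k) \<Rightarrow> 'x \<Rightarrow> 'k"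
  by standard (auto simp: pointwise_scale_def fun_eq_iff algebra_simps)

lemma sum_fun_apply: "(\<Sum>i\<in>A. f i) x = (\<Sum>i\<in>A. f i x)" for f :: "'i \<Rightarrow> 'x \<Rightarrow> 'k::comm_monoid_add"
  by (induction A rule: infinite_finite_induct) auto

lemma subspace_chains: "fun_space.subspace (chains X k)"
  by (rule fun_space.subspaceI) (auto simp: chains_def pointwise_scale_def)

text \<open>The defining sum runs over the support of \<open>c\<close>, which varies with
  \<open>c\<close>. Over the fixed finite set of cells linearity becomes visible.\<close>

lemma boundary_chain:
  assumes "c \<in> chains X k" "finite (cells X k)"
  shows "boundary c P = (\<Sum>Q\<in>cells X k. c Q * of_int (incidence Q P))"
  unfolding boundary_def using assms
  by (intro sum.mono_neutral_left) (auto simp: chains_def)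

lemma augmentation_chain:
  assumes "c \<in> chains X k" "finite (cells X k)"
  shows "augmentation c = (\<Sum>Q\<in>cells X k. c Q)"
  unfolding augmentation_def using assms
  by (intro sum.mono_neutral_left) (auto simp: chains_def)

lemma chains_add: "c \<in> chains X k \<Longrightarrow> e \<in> chains X k \<Longrightarrow> c + e \<in> chains X k"
  and chains_scale: "c \<in> chains X k \<Longrightarrow> pointwise_scale a c \<in> chains X k"
  and chains_0: "0 \<in> chains X k"
  using fun_space.subspace_add fun_space.subspace_scale fun_space.subspace_0 subspace_chains
  by blast+

lemma boundary_linear:
  assumes "finite (cells X k)" "c \<in> chains X k" "e \<in> chains X k"
  shows "boundary (c + e) = boundary c + boundary e"
    and "boundary (pointwise_scale a c) = pointwise_scale a (boundary c)"
proof -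
  note boundary = boundary_chain[OF _ assms(1)]
  show "boundary (c + e) = boundary c + boundary e"
    by (rule ext) (simp add: boundary chains_add assms sum.distrib distrib_right)
  show "boundary (pointwise_scale a c) = pointwise_scale a (boundary c)"
    by (rule ext) (simp add: boundary chains_scale assms sum_distrib_left mult.assoc)
qed

lemma augmentation_linear:
  assumes "finite (cells X k)" "c \<in> chains X k" "e \<in> chains X k"
  shows "augmentation (c + e) = augmentation c + augmentation e"
    and "augmentation (pointwise_scale a c) = a * augmentation c"
proof -
  note augmentation = augmentation_chain[OF _ assms(1)]
  show "augmentation (c + e) = augmentation c + augmentation e"
    by (simp add: augmentation chains_add assms sum.distrib)
  show "augmentation (pointwise_scale a c) = a * augmentation c"
    by (simp add: augmentation chains_scale assms sum_distrib_left)
qed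

lemma boundary_0: "boundary 0 = 0" and augmentation_0: "augmentation 0 = 0"
  by (auto simp: boundary_def augmentation_def fun_eq_iff)

lemma subspace_reduced_cycles:
  assumes "finite (cells X k)"
  shows "fun_space.subspace (reduced_cycles X k)"
proof (rule fun_space.subspaceI)
  show "0 \<in> reduced_cycles X k"
    by (auto simp: reduced_cycles_def chains_0 boundary_0 augmentation_0)
next
  fix c e :: "cube \<Rightarrow> 'a"
  assume "c \<in> reduced_cycles X k" "e \<in> reduced_cycles X k"
  then show "c + e \<in> reduced_cycles X k"
    by (auto simp: reduced_cycles_def chains_add boundary_linear[OF assms]
        augmentation_linear[OF assms] split: if_splits)
next
  fix a and c :: "cube \<Rightarrow> 'a"
  assume "c \<in> reduced_cycles X k"
  then show "pointwise_scale a c \<in> reduced_cycles X k"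
    using boundary_linear(2)[OF assms, of c c a] augmentation_linear(2)[OF assms, of c c a]
    by (auto simp: reduced_cycles_def chains_scale split: if_splits)
qed

lemma subspace_boundaries:
  assumes "finite (cells X (Suc k))"
  shows "fun_space.subspace (boundaries X k)"
  unfolding boundaries_def Suc_eq_plus1[symmetric]
proof (rule fun_space.subspaceI)
  show "0 \<in> boundary ` chains X (Suc k)"
    using boundary_0[symmetric] chains_0 by (rule image_eqI)
next
  fix c e :: "cube \<Rightarrow> 'a"
  assume "c \<in> boundary ` chains X (Suc k)" "e \<in> boundary ` chains X (Suc k)"
  then show "c + e \<in> boundary ` chains X (Suc k)"
    using boundary_linear(1)[OF assms, symmetric] by (auto intro!: image_eqI chains_add)
next
  fix a and c :: "cube \<Rightarrow> 'a"
  assume "c \<in> boundary ` chains X (Suc k)"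
  then show "pointwise_scale a c \<in> boundary ` chains X (Suc k)"
    using boundary_linear(2)[OF assms, symmetric] by (auto intro!: image_eqI chains_scale)
qed

text \<open>The indicator functions of the \<open>k\<close>-cells span. Through their number the
  count of cells bounds the dimension of the cycle space.\<close>

lemma chains_finite_span:
  assumes "finite (cells X k)"
  shows "\<exists>G. finite G \<and> card G \<le> card (cells X k) \<and> chains X k \<subseteq> fun_space.span G"
proof (intro exI conjI subsetI)
  let ?e = "\<lambda>Q P. if P = Q then 1 else (0::'a)"
  let ?G = "?e ` cells X k"
  show "finite ?G" "card ?G \<le> card (cells X k)"
    using assms by (auto intro: card_image_le)
  fix c :: "cube \<Rightarrow> 'a"
  assume c: "c \<in> chains X k"
  have eq: "c P = (\<Sum>Q\<in>cells X k. pointwise_scale (c Q) (?e Q) P)" for P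
  proof -
    have "(\<Sum>Q\<in>cells X k. pointwise_scale (c Q) (?e Q) P) = (\<Sum>Q\<in>cells X k. if P = Q then c Q else 0)"
      by (intro sum.cong) (auto simp: pointwise_scale_def)
    also have "\<dots> = c P" using c assms by (auto simp: chains_def)
    finally show ?thesis ..
  qed
  have "c = (\<Sum>Q\<in>cells X k. pointwise_scale (c Q) (?e Q))"
    by (rule ext, subst sum_fun_apply, rule eq)
  also have "\<dots> \<in> fun_space.span ?G"
    by (intro fun_space.span_sum fun_space.span_scale fun_space.span_base) auto
  finally show "c \<in> fun_space.span ?G" .
qed

text \<open>Classes are cosets of the subspace of boundaries.\<close>

lemma homology_class_eq_iff:
  assumes "finite (cells X (Suc k))"
  shows "homology_class X k c = homology_class X k c' \<longleftrightarrow> c - c' \<in> boundaries X k"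
proof -
  note B = subspace_boundaries[OF assms]
  have cls: "x \<in> homology_class X k c \<longleftrightarrow> x - c \<in> boundaries X k" for x c :: "cube \<Rightarrow> 'a"
  proof
    assume "x \<in> homology_class X k c"
    then obtain e where "e \<in> boundaries X k" "x = (\<lambda>Q. c Q + e Q)" by (auto simp: homology_class_def)
    moreover from this have "x - c = e" by (auto simp: fun_eq_iff)
    ultimately show "x - c \<in> boundaries X k" by simp
  next
    assume "x - c \<in> boundaries X k"
    then show "x \<in> homology_class X k c"
      unfolding homology_class_def by (intro CollectI exI[of _ "x - c"]) (auto simp: fun_eq_iff)
  qed
  show ?thesis
  proof
    assume "homology_class X k c = homology_class X k c'"
    then show "c - c' \<in> boundaries X k"
      using cls[of c c] cls[of c c'] fun_space.subspace_0[OF B] by simp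
  next
    assume "c - c' \<in> boundaries X k"
    then have "x - c \<in> boundaries X k \<longleftrightarrow> x - c' \<in> boundaries X k" for x
      using fun_space.subspace_add[OF B, of "x - c" "c - c'"]
        fun_space.subspace_diff[OF B, of "x - c'" "c - c'"] by auto
    then show "homology_class X k c = homology_class X k c'"
      using cls by blast
  qed
qed

text \<open>Translates the basis clause of \<open>interval_decomposition\<close> into
  \<open>basis_modulo\<close>, so that the linear algebra above applies.\<close>

lemma homology_basis_iff:
  assumes "finite (cells X (Suc k))"
  shows "(\<forall>h\<in>reduced_homology X k. \<exists>!a. a \<in> extensional A \<and>
            h = homology_class X k (\<lambda>Q. \<Sum>i\<in>A. a i * z i Q)) \<longleftrightarrow>
         basis_modulo pointwise_scale (reduced_cycles X k) (boundaries X k) A z"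
proof -
  have "(\<lambda>Q. \<Sum>i\<in>A. a i * z i Q) = (\<Sum>i\<in>A. pointwise_scale (a i) (z i))" for a :: "'b \<Rightarrow> 'a"
    by (auto simp: fun_eq_iff sum_fun_apply pointwise_scale_def)
  then show ?thesis
    by (simp add: reduced_homology_def basis_modulo_def homology_class_eq_iff[OF assms])
qed

section \<open>Persistent homology when only the cells of dimension \<open>k + 1\<close>
  vary\<close>

text \<open>Degree \<open>k\<close> homology depends only on the cells of dimensions
  \<open>k\<close> and \<open>k + 1\<close>. In the Bernoulli process \<open>k\<close> is
  \<open>l - 1\<close>, \<open>C\<close> the set of \<open>k\<close>-cells and \<open>S\<close> the
  set of \<open>l\<close>-cells with entry times \<open>\<tau>\<close>.\<close>

locale fixed_skeleton_filtration =
  fixes F :: "real \<Rightarrow> cube set" and k :: nat and C S :: "cube set" and \<tau> :: "cube \<Rightarrow> real"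
  assumes finite: "finite C" "finite S"
    and cells_k: "t \<in> {0..1} \<Longrightarrow> cells (F t) k = C"
    and cells_Suc: "t \<in> {0..1} \<Longrightarrow> cells (F t) (Suc k) = {\<sigma> \<in> S. \<tau> \<sigma> \<le> t}"
begin

lemma cycles_const:
  assumes "t \<in> {0..1}"
  shows "reduced_cycles (F t) k = reduced_cycles (F 0) k"
  using cells_k[OF assms] cells_k[of 0] by (simp add: reduced_cycles_def chains_def)

lemma boundaries_mono:
  assumes "s \<in> {0..1}" "t \<in> {0..1}" "s \<le> t"
  shows "boundaries (F s) k \<subseteq> boundaries (F t) k"
  unfolding boundaries_def using assms
  by (intro image_mono) (auto simp: chains_def cells_Suc)

lemma finite_cells:
  assumes "t \<in> {0..1}"
  shows "finite (cells (F t) k)" "finite (cells (F t) (Suc k))"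
  using finite assms by (auto simp: cells_k cells_Suc)

text \<open>The generators alive at \<open>t\<close> form a basis of the cycles modulo the
  boundaries, so their number depends on the filtration alone. The subtraction of naturals is exact
  by \<open>basis_modulo_card\<close>.\<close>

lemma card_alive:
  fixes z :: "nat \<Rightarrow> cube \<Rightarrow> 'k::field"
  assumes dec: "interval_decomposition F k I b d z" and t: "t \<in> {0..1}"
  shows "card {i \<in> I. b i \<le> t \<and> ereal t < d i} =
      fun_space.dim (reduced_cycles (F 0) k :: (cube \<Rightarrow> 'k) set) -
      fun_space.dim (boundaries (F t) k \<inter> reduced_cycles (F 0) k :: (cube \<Rightarrow> 'k) set)"
    and "card {i \<in> I. b i \<le> t \<and> ereal t < d i} \<le> card C"
proof -
  let ?A = "{i \<in> I. b i \<le> t \<and> ereal t < d i}"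
  let ?Z = "reduced_cycles (F 0) k :: (cube \<Rightarrow> 'k) set"
  note Z = cycles_const[OF t]
  have basis: "basis_modulo pointwise_scale ?Z (boundaries (F t) k) ?A z"
    using dec t unfolding interval_decomposition_def Let_def
    by (subst Z[symmetric], subst homology_basis_iff[symmetric]) (auto intro: finite_cells)
  obtain G where G: "finite G" "card G \<le> card C" "(chains (F 0) k :: (cube \<Rightarrow> 'k) set) \<subseteq> fun_space.span G"
    using chains_finite_span[OF finite_cells(1)[of 0]] cells_k[of 0] by auto
  have sub: "fun_space.subspace ?Z" "fun_space.subspace (boundaries (F t) k :: (cube \<Rightarrow> 'k) set)"
    using finite_cells t by (auto intro!: subspace_reduced_cycles subspace_boundaries)
  have span: "?Z \<subseteq> fun_space.span G" using G by (auto simp: reduced_cycles_def)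
  \<comment> \<open>A generator is a cycle at its own birth time, and the cycle space does not
    change with time.\<close>
  have "z i \<in> ?Z" if "i \<in> I" for i
  proof -
    have "z i \<in> reduced_cycles (F (b i)) k" "b i \<in> {0..1}"
      using dec that by (auto simp: interval_decomposition_def)
    then show ?thesis using cycles_const[of "b i", where 'a = 'k] by blast
  qed
  then have A: "finite ?A" "z ` ?A \<subseteq> ?Z"
    using dec by (auto simp: interval_decomposition_def)
  note * = fun_space.basis_modulo_card[OF sub(1) span G(1) sub(2) A basis]
  from * show "card ?A = fun_space.dim ?Z - fun_space.dim (boundaries (F t) k \<inter> ?Z)"
    by simp
  from * G show "card ?A \<le> card C" by simp
qed

text \<open>Each lifetime is the integral of the indicator of its interval, and the finite sum is
  exchanged with the integral. The right-hand side does not mention the decomposition, which gives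
  uniqueness of the lifetime sum; bounding the integrand by \<open>card C\<close> on
  \<open>[0,1)\<close> gives the estimate.\<close>

lemma lifetimes_eq_integral:
  fixes z :: "nat \<Rightarrow> cube \<Rightarrow> 'k::field"
  assumes dec: "interval_decomposition F k I b d z"
  shows "(\<Sum>i\<in>I. death_time (d i) - b i) = (LINT t|lborel. indicator {0..<1} t *
      real (fun_space.dim (reduced_cycles (F 0) k :: (cube \<Rightarrow> 'k) set) -
      fun_space.dim (boundaries (F t) k \<inter> reduced_cycles (F 0) k :: (cube \<Rightarrow> 'k) set)))"
    and "0 \<le> (\<Sum>i\<in>I. death_time (d i) - b i)"
    and "(\<Sum>i\<in>I. death_time (d i) - b i) \<le> card C"
proof -
  let ?e = "\<lambda>i. death_time (d i)"
  have I: "finite I" using dec by (simp add: interval_decomposition_def)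
  have bd: "0 \<le> b i" "b i \<le> ?e i" "?e i \<le> 1" and alive: "t < 1 \<Longrightarrow> t < ?e i \<longleftrightarrow> ereal t < d i"
    if "i \<in> I" for i t
  proof -
    from dec that have "0 \<le> b i" "b i \<le> 1" "ereal (b i) < d i" "d i \<le> 1 \<or> d i = \<infinity>"
      by (auto simp: interval_decomposition_def)
    then show "0 \<le> b i" "b i \<le> ?e i" "?e i \<le> 1" "t < 1 \<Longrightarrow> t < ?e i \<longleftrightarrow> ereal t < d i"
      by (cases "d i"; simp add: death_time_def)+
  qed
  have int: "integrable lborel (\<lambda>t. indicator {b i..<?e i} t :: real)" if "i \<in> I" for i
    using bd[OF that] by (intro integrable_real_indicator) auto
  have "(\<Sum>i\<in>I. ?e i - b i) = (\<Sum>i\<in>I. LINT t|lborel. indicator {b i..<?e i} t)"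
    using bd by (intro sum.cong) auto
  also have "\<dots> = (LINT t|lborel. (\<Sum>i\<in>I. indicator {b i..<?e i} t))"
    using int by (intro Bochner_Integration.integral_sum[symmetric]) auto
  finally have sum: "(\<Sum>i\<in>I. ?e i - b i) = (LINT t|lborel. (\<Sum>i\<in>I. indicator {b i..<?e i} t))" .
  \<comment> \<open>The point 1 is left out on the right: a class that never dies is alive there,
    but its interval, with death time set to 1, no longer contains it.\<close>
  have count: "(\<Sum>i\<in>I. indicator {b i..<?e i} t :: real) =
      indicator {0..<1} t * real (card {i \<in> I. b i \<le> t \<and> ereal t < d i})" for t
  proof (cases "t \<in> {0..<1}")
    case True
    have "(\<Sum>i\<in>I. indicator {b i..<?e i} t :: real) = (\<Sum>i\<in>I. if b i \<le> t \<and> ereal t < d i then 1 else 0)"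
      using True alive by (intro sum.cong) (auto simp: indicator_def)
    with True I show ?thesis by (simp add: sum.If_cases Int_def)
  next
    case False
    then have "indicator {b i..<?e i} t = (0::real)" if "i \<in> I" for i
      using bd[OF that] by (auto simp: indicator_def)
    with False show ?thesis by simp
  qed
  show "(\<Sum>i\<in>I. ?e i - b i) = (LINT t|lborel. indicator {0..<1} t *
      real (fun_space.dim (reduced_cycles (F 0) k :: (cube \<Rightarrow> 'k) set) -
      fun_space.dim (boundaries (F t) k \<inter> reduced_cycles (F 0) k :: (cube \<Rightarrow> 'k) set)))"
    unfolding sum count using card_alive(1)[OF dec]
    by (intro Bochner_Integration.integral_cong) (auto simp: indicator_def)
  show "0 \<le> (\<Sum>i\<in>I. ?e i - b i)" using bd by (intro sum_nonneg) auto
  have "(LINT t|lborel. (\<Sum>i\<in>I. indicator {b i..<?e i} t)) \<le>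
      (LINT t|lborel. indicator {0..<1::real} t * real (card C))"
  proof (rule integral_mono)
    show "(\<Sum>i\<in>I. indicator {b i..<?e i} t) \<le> indicator {0..<1} t * real (card C)" for t
      unfolding count using card_alive(2)[OF dec, of t] by (auto simp: indicator_def)
  qed (use int in auto)
  then show "(\<Sum>i\<in>I. ?e i - b i) \<le> card C" unfolding sum by simp
qed

text \<open>All births are at 0. For a basis \<open>E\<close> of the cycles adapted to the growing
  boundary spaces, each basis vector dies when it first becomes a boundary, and the vectors of
  \<open>E\<close> that are not yet boundaries form a basis of homology at every time.\<close>

lemma interval_decomposition_exists:
  "\<exists>I b d (z :: nat \<Rightarrow> cube \<Rightarrow> 'k::field). interval_decomposition F k I b d z"
proof -
  let ?Z = "reduced_cycles (F 0) k :: (cube \<Rightarrow> 'k) set"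
  let ?B = "\<lambda>t. boundaries (F t) k :: (cube \<Rightarrow> 'k) set"
  \<comment> \<open>The finitely many times at which the boundaries can change. Entry times below 0
    have passed from the start and those above 1 are never reached; including 0 gives every
    \<open>t\<close> in \<open>[0,1]\<close> a predecessor in \<open>T\<close>.\<close>
  define T where "T = insert 0 {t \<in> \<tau> ` S. 0 \<le> t \<and> t \<le> 1}"
  have T: "finite T" "T \<subseteq> {0..1}" using finite by (auto simp: T_def)
  \<comment> \<open>No cell enters between the largest critical time up to \<open>t\<close> and
    \<open>t\<close> itself.\<close>
  have jump: "\<exists>s\<in>T. s \<le> t \<and> ?B t = ?B s" if t: "t \<in> {0..1}" for t
  proof
    let ?s = "Max {s \<in> T. s \<le> t}"
    have fin: "finite {s \<in> T. s \<le> t}" and "0 \<in> {s \<in> T. s \<le> t}" using T t by (auto simp: T_def)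
    then have s: "?s \<in> {s \<in> T. s \<le> t}" by (intro Max_in) blast+
    have ge: "s \<le> ?s" if "s \<in> T" "s \<le> t" for s using that fin by (intro Max_ge) auto
    have "\<tau> \<sigma> \<le> t \<longleftrightarrow> \<tau> \<sigma> \<le> ?s" if "\<sigma> \<in> S" for \<sigma>
    proof (cases "0 \<le> \<tau> \<sigma>")
      case True
      with that t have "\<tau> \<sigma> \<le> t \<Longrightarrow> \<tau> \<sigma> \<in> T" by (auto simp: T_def)
      with ge[of "\<tau> \<sigma>"] s show ?thesis by auto
    next
      case False
      with s t T show ?thesis by auto
    qed
    then have "cells (F t) (Suc k) = cells (F ?s) (Suc k)"
      using t s T by (subst (1 2) cells_Suc) auto
    with s show "?s \<le> t \<and> ?B t = ?B ?s" by (auto simp: boundaries_def chains_def)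
    show "?s \<in> T" using s by auto
  qed
  have sub: "fun_space.subspace ?Z" "t \<in> {0..1} \<Longrightarrow> fun_space.subspace (?B t)" for t
    using finite_cells by (auto intro!: subspace_reduced_cycles subspace_boundaries)
  \<comment> \<open>The extra index \<open>2 > 1\<close> puts the space of all cycles on top of the filtration.\<close>
  define W where "W t = (if t \<le> 1 then ?B t \<inter> ?Z else ?Z)" for t
  have "\<exists>E. fun_space.independent E \<and> E \<subseteq> (\<Union>t\<in>insert 2 T. W t) \<and>
      (\<forall>t\<in>insert 2 T. fun_space.span (E \<inter> W t) = W t)"
  proof (rule fun_space.filtration_basis_exists)
    show "finite (insert 2 T)" using T by simp
    show "fun_space.subspace (W t)" if "t \<in> insert 2 T" for t
      using that T sub by (auto simp: W_def intro!: fun_space.subspace_inter)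
    show "W s \<subseteq> W t" if "s \<in> insert 2 T" "t \<in> insert 2 T" "s \<le> t" for s t
    proof (cases "t \<le> 1")
      case True
      with that T have "s \<in> {0..1}" "t \<in> {0..1}" by auto
      then have "?B s \<subseteq> ?B t" using that by (intro boundaries_mono)
      with True that show ?thesis by (auto simp: W_def)
    qed (simp add: W_def)
  qed
  then obtain E where E: "fun_space.independent E" "E \<subseteq> (\<Union>t\<in>insert 2 T. W t)"
    "\<And>t. t \<in> insert 2 T \<Longrightarrow> fun_space.span (E \<inter> W t) = W t" by blast
  have EZ: "E \<subseteq> ?Z" using E(2) by (auto simp: W_def split: if_splits)
  have spanE: "fun_space.span E = ?Z" using E(3)[of 2] EZ by (simp add: W_def Int_absorb2)
  obtain G where G: "finite G" "(chains (F 0) k :: (cube \<Rightarrow> 'k) set) \<subseteq> fun_space.span G"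
    using chains_finite_span[OF finite_cells(1)[of 0]] by auto
  with EZ have "E \<subseteq> fun_space.span G" by (auto simp: reduced_cycles_def)
  with G E(1) have finE: "finite E" using fun_space.independent_span_bound by blast
  then obtain z and N :: nat where z: "bij_betw z {0..<N} E" using ex_bij_betw_nat_finite by blast
  then have zE: "z i \<in> E" if "i < N" for i using that by (auto simp: bij_betw_def)
  \<comment> \<open>The first critical time at which \<open>z i\<close> bounds. By
    \<open>jump\<close> no earlier time is missed.\<close>
  define d where "d i = (if \<exists>s\<in>T. z i \<in> ?B s then ereal (Min {s \<in> T. z i \<in> ?B s}) else \<infinity>)" for i
  have d: "d i \<le> ereal t \<longleftrightarrow> z i \<in> ?B t" if t: "t \<in> {0..1}" for i t
  proof
    assume le: "d i \<le> ereal t"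
    then have ex: "\<exists>s\<in>T. z i \<in> ?B s" by (auto simp: d_def split: if_splits)
    let ?s = "Min {s \<in> T. z i \<in> ?B s}"
    have "?s \<in> {s \<in> T. z i \<in> ?B s}" using ex T by (intro Min_in) auto
    moreover have "?s \<le> t" using le ex by (simp add: d_def)
    ultimately show "z i \<in> ?B t" using boundaries_mono[of ?s t, where 'a = 'k] T t by blast
  next
    assume "z i \<in> ?B t"
    with jump[OF t] obtain s where s: "s \<in> T" "s \<le> t" "z i \<in> ?B s" by auto
    then have "Min {s \<in> T. z i \<in> ?B s} \<le> s" using T by (intro Min_le) auto
    with s show "d i \<le> ereal t" by (auto simp: d_def)
  qed
  have d_range: "d i \<le> 1 \<or> d i = \<infinity>" for i
  proof (cases "\<exists>s\<in>T. z i \<in> ?B s")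
    case True
    then obtain s where s: "s \<in> T" "z i \<in> ?B s" by blast
    then have "d i \<le> ereal s" using d T by auto
    also have "\<dots> \<le> 1" using s T by auto
    finally show ?thesis ..
  qed (simp add: d_def)
  \<comment> \<open>Vectors that already bound at time 0 would have an empty interval, while a
    decomposition requires birth before death.\<close>
  define I where "I = {i \<in> {0..<N}. z i \<notin> ?B 0}"
  have "interval_decomposition F k I (\<lambda>_. 0) d z"
    unfolding interval_decomposition_def Let_def
  proof (intro conjI ballI impI)
    show "finite I" by (simp add: I_def)
    show "ereal 0 < d i" if "i \<in> I" for i
      using that d[of 0 i] by (simp add: I_def not_le[symmetric])
    show "z i \<in> reduced_cycles (F 0) k" if "i \<in> I" for i
      using that zE EZ by (auto simp: I_def)
    show "homology_class (F t) k (z i) = homology_class (F t) k (\<lambda>_. 0)"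
      if "i \<in> I" "t \<in> {0..1}" "d i \<le> ereal t" for i t
    proof -
      have "z i - (\<lambda>_. 0) = z i" by (auto simp: fun_eq_iff)
      with that d show ?thesis by (simp add: homology_class_eq_iff finite_cells)
    qed
    show "d i \<le> 1 \<or> d i = \<infinity>" for i by (rule d_range)
  next
    fix t :: real and h :: "(cube \<Rightarrow> 'k) set"
    assume t: "t \<in> {0..1}" and h: "h \<in> reduced_homology (F t) k"
    let ?A = "{i \<in> I. 0 \<le> t \<and> ereal t < d i}"
    have A: "?A = {i \<in> {0..<N}. z i \<notin> ?B t}"
      using d[OF t] t boundaries_mono[of 0 t, where 'a = 'k] by (auto simp: I_def not_le[symmetric])
    have "bij_betw z ?A (E - ?B t)"
      unfolding A
    proof (rule bij_betw_subset[OF z])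
      show "z ` {i \<in> {0..<N}. z i \<notin> ?B t} = E - ?B t"
        unfolding bij_betw_imp_surj_on[OF z, symmetric] by blast
    qed auto
    \<comment> \<open>\<open>E\<close> is adapted to the spaces at critical times only;
      \<open>jump\<close> carries this over to arbitrary \<open>t\<close>.\<close>
    moreover have "fun_space.span (E \<inter> ?B t) = ?B t \<inter> ?Z"
    proof -
      obtain s where s: "s \<in> T" "?B t = ?B s" using jump[OF t] by blast
      then have "W s = ?B t \<inter> ?Z" using T by (auto simp: W_def)
      moreover have "E \<inter> (?B t \<inter> ?Z) = E \<inter> ?B t" using EZ by auto
      ultimately show ?thesis using E(3)[of s] s by simp
    qed
    ultimately have "basis_modulo pointwise_scale ?Z (?B t) ?A z"
      using E(1) finE spanE sub t by (intro fun_space.basis_modulo_complement) auto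
    then show "\<exists>!a. a \<in> extensional ?A \<and> h = homology_class (F t) k (\<lambda>Q. \<Sum>i\<in>?A. a i * z i Q)"
      using h homology_basis_iff[OF finite_cells(2)[OF t], of ?A z] by (simp add: cycles_const[OF t])
  qed auto
  then show ?thesis by blast
qed

text \<open>Existence of a decomposition and the integral formula, which gives all decompositions
  the same sum, justify the definite description. The bounds then pass to its value.\<close>

lemma lifetime_sum_bounds:
  shows "0 \<le> lifetime_sum TYPE('k::field) F k" and "lifetime_sum TYPE('k) F k \<le> card C"
proof -
  obtain I b d and z :: "nat \<Rightarrow> cube \<Rightarrow> 'k" where dec: "interval_decomposition F k I b d z"
    using interval_decomposition_exists by blast
  have "lifetime_sum TYPE('k) F k = (\<Sum>i\<in>I. death_time (d i) - b i)"
    unfolding lifetime_sum_def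
  proof (rule the_equality)
    fix L assume "\<exists>I b d (z :: nat \<Rightarrow> cube \<Rightarrow> 'k). interval_decomposition F k I b d z \<and>
        L = (\<Sum>i\<in>I. death_time (d i) - b i)"
    then obtain I' b' d' and z' :: "nat \<Rightarrow> cube \<Rightarrow> 'k"
      where dec': "interval_decomposition F k I' b' d' z'"
        and L: "L = (\<Sum>i\<in>I'. death_time (d' i) - b' i)" by blast
    show "L = (\<Sum>i\<in>I. death_time (d i) - b i)"
      unfolding L lifetimes_eq_integral(1)[OF dec] by (rule lifetimes_eq_integral(1)[OF dec'])
  qed (use dec in blast)
  with lifetimes_eq_integral(2,3)[OF dec]
  show "0 \<le> lifetime_sum TYPE('k) F k" "lifetime_sum TYPE('k) F k \<le> card C" by simp_all
qed

end

section \<open>Counting the cubes of the lattice\<close>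

lemma mem_listset_iff: "xs \<in> listset As \<longleftrightarrow> list_all2 (\<in>) xs As"
  by (induction As arbitrary: xs) (auto simp: set_Cons_def list_all2_Cons2)

text \<open>Inclusion of a product passes to its factors because all factors are nonempty, so that a
  point of one factor extends to a point of the cube.\<close>

lemma full_cubical_lattice_intervals:
  assumes "Q \<in> full_cubical_lattice l n" "I \<in> set Q"
  shows "interval_set I \<subseteq> {0..real n}"
proof
  fix x assume x: "x \<in> interval_set I"
  from assms obtain i where i: "i < length Q" "Q ! i = I" by (auto simp: in_set_conv_nth)
  have nonempty: "interval_set J \<noteq> {}" for J by (cases J) auto
  define p where "p j = (if j = i then x else (SOME y. y \<in> interval_set (Q ! j)))" for j
  have p: "p j \<in> interval_set (Q ! j)" for j
    using x i nonempty[of "Q ! j"] by (auto simp: p_def some_in_eq)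
  have "map p [0..<length Q] \<in> cube_set Q"
    by (auto simp: cube_set_def mem_listset_iff list_all2_conv_all_nth p)
  with assms have "list_all2 (\<in>) (map p [0..<length Q]) (replicate (l + 1) {0..real n})"
    unfolding full_cubical_lattice_def mem_listset_iff[symmetric] by blast
  moreover have "length Q = l + 1" using assms by (simp add: full_cubical_lattice_def)
  ultimately have "p i \<in> {0..real n}"
    using list_all2_nthD[of "(\<in>)" "map p [0..<length Q]" "replicate (l + 1) {0..real n}" i] i by (simp del: upt_Suc replicate_Suc)
  then show "x \<in> {0..real n}" by (simp add: p_def)
qed

lemma full_cubical_lattice_card:
  shows "finite (full_cubical_lattice l n)"
    and "card (full_cubical_lattice l n) \<le> (2 * (n + 1)) ^ (l + 1)"
proof -
  \<comment> \<open>\<open>Nondegenerate\<close> at \<open>n\<close> sticks out of the box; it is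
    kept so that both kinds contribute \<open>n + 1\<close> intervals.\<close>
  let ?J = "Degenerate ` {0..int n} \<union> Nondegenerate ` {0..int n}"
  have J: "I \<in> ?J" if "interval_set I \<subseteq> {0..real n}" for I
    using that by (cases I) auto
  have sub: "full_cubical_lattice l n \<subseteq> {Q. set Q \<subseteq> ?J \<and> length Q = l + 1}"
  proof (rule subsetI, rule CollectI, rule conjI)
    fix Q assume Q: "Q \<in> full_cubical_lattice l n"
    show "set Q \<subseteq> ?J" by (rule subsetI) (rule J[OF full_cubical_lattice_intervals[OF Q]])
    show "length Q = l + 1" using Q by (simp add: full_cubical_lattice_def)
  qed
  have fin: "finite ?J" by simp
  have "card ?J \<le> card (Degenerate ` {0..int n}) + card (Nondegenerate ` {0..int n})"
    by (rule card_Un_le)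
  also have "\<dots> = 2 * (n + 1)"
    by (simp add: card_image inj_on_def)
  finally have cardJ: "card ?J \<le> 2 * (n + 1)" .
  show "finite (full_cubical_lattice l n)"
    using sub finite_lists_length_eq[OF fin] by (rule finite_subset)
  have "card (full_cubical_lattice l n) \<le> card {Q. set Q \<subseteq> ?J \<and> length Q = l + 1}"
    using sub finite_lists_length_eq[OF fin] by (intro card_mono)
  also have "\<dots> \<le> (2 * (n + 1)) ^ (l + 1)"
    unfolding card_lists_length_eq[OF fin] using cardJ by (rule power_mono) simp
  finally show "card (full_cubical_lattice l n) \<le> (2 * (n + 1)) ^ (l + 1)" .
qed

section \<open>The Bernoulli process and its expected lifetime sum\<close>

text \<open>As \<open>l \<ge> 1\<close>, the successor of \<open>l - 1\<close> is \<open>l\<close>;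
  the skeleton supplies all \<open>(l - 1)\<close>-cells and no \<open>l\<close>-cell.\<close>

lemma bernoulli_process_filtration:
  assumes "finite X" "l \<ge> 1"
  shows "fixed_skeleton_filtration (bernoulli_process X l \<tau>) (l - 1) (cells X (l - 1)) (cells X l) \<tau>"
  using assms by unfold_locales (auto simp: bernoulli_process_def cells_def skeleton_def)

theorem theorem3p3:
  fixes l :: nat
    and M :: "nat \<Rightarrow> 'w measure"
    and \<tau> :: "nat \<Rightarrow> cube \<Rightarrow> 'w \<Rightarrow> real"
  assumes "l \<ge> 1"
    and "\<And>n. n \<ge> 1 \<Longrightarrow> prob_space (M n)"
    and "\<And>n. n \<ge> 1 \<Longrightarrow> iid_uniform (M n) (cells (cubical_lattice l n) l) (\<tau> n)"
  shows "(\<lambda>n. prob_space.expectation (M n)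
            (\<lambda>\<omega>. lifetime_sum TYPE('k::field_char_0)
                    (bernoulli_process (cubical_lattice l n) l (\<lambda>\<sigma>. \<tau> n \<sigma> \<omega>)) (l - 1)))
         \<in> O(\<lambda>n. real n ^ (l + 1))"
proof (rule bigoI)
  show "\<forall>\<^sub>F n in sequentially. norm (prob_space.expectation (M n)
            (\<lambda>\<omega>. lifetime_sum TYPE('k::field_char_0)
                    (bernoulli_process (cubical_lattice l n) l (\<lambda>\<sigma>. \<tau> n \<sigma> \<omega>)) (l - 1)))
         \<le> 4 ^ (l + 1) * norm (real n ^ (l + 1))"
    using eventually_ge_at_top[of 1]
  proof eventually_elim
    case (elim n)
    interpret prob_space "M n" using assms(2) elim .
    let ?X = "cubical_lattice l n"
    let ?L = "\<lambda>\<omega>. lifetime_sum TYPE('k) (bernoulli_process ?X l (\<lambda>\<sigma>. \<tau> n \<sigma> \<omega>)) (l - 1)"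
    have X: "finite ?X"
      using full_cubical_lattice_card(1) by (auto simp: cubical_lattice_def skeleton_def)
    have bounds: "0 \<le> ?L \<omega>" "?L \<omega> \<le> card (cells ?X (l - 1))" for \<omega>
      using fixed_skeleton_filtration.lifetime_sum_bounds[OF bernoulli_process_filtration[OF X assms(1)]]
      by auto
    have "card (cells ?X (l - 1)) \<le> card (full_cubical_lattice l n)"
      by (intro card_mono full_cubical_lattice_card) (auto simp: cells_def cubical_lattice_def skeleton_def)
    also have "\<dots> \<le> (2 * (n + 1)) ^ (l + 1)" by (rule full_cubical_lattice_card)
    \<comment> \<open>\<open>n \<ge> 1\<close> gives \<open>2 * (n + 1) \<le> 4 * n\<close>, whence
      the constant \<open>4 ^ (l + 1)\<close>.\<close>
    also have "\<dots> \<le> (4 * n) ^ (l + 1)" using elim by (intro power_mono) auto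
    finally have "real (card (cells ?X (l - 1))) \<le> real ((4 * n) ^ (l + 1))"
      by (rule of_nat_mono)
    then have card: "real (card (cells ?X (l - 1))) \<le> 4 ^ (l + 1) * real n ^ (l + 1)"
      by (simp only: power_mult_distrib of_nat_mult of_nat_power of_nat_numeral)
    have "expectation ?L \<le> card (cells ?X (l - 1))"
    \<comment> \<open>Without integrability the expectation is 0 by convention, which a cardinality
      still bounds.\<close>
    proof (cases "integrable (M n) ?L")
      case True
      then show ?thesis using bounds by (intro integral_le_const) auto
    next
      case False
      then show ?thesis by (simp add: not_integrable_integral_eq)
    qed
    moreover have "0 \<le> expectation ?L" using bounds by (intro integral_nonneg_AE) auto
    ultimately show ?case using card by simp
  qed
qed

end
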